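(* Every maximal peak-pit Condorcet domain is directly connected.
   Context: Let $A$ be a finite set and $\mathcal L(A)$ the set of linear orders on $A$, written as words from top to bottom. For a domain $\mathcal D\subseteq\mathcal L(A)$ and $B\subseteq A$, $\mathcal D_B$ is the set of restrictions to $B$ of orders in $\mathcal D$. For distinct $a,b,c$, $x\in\{a,b,c\}$, $k\in\{1,2,3\}$, $\mathcal D_{\{a,b,c\}}$ satisfies $xN_{\{a,b,c\}}k$ if no order in $\mathcal D_{\{a,b,c\}}$ has $x$ in position $k$. $\mathcal D$ is a peak-pit Condorcet domain if for every triple of distinct alternatives, $\mathcal D_{\{a,b,c\}}$ satisfies $xN_{\{a,b,c\}}1$ or $xN_{\{a,b,c\}}3$ for some $x\in\{a,b,c\}$. A peak-pit Condorcet domain $\mathcal D\subseteq\mathcal L(A)$ is a maximal peak-pit Condorcet domain if every peak-pit Condorcet domain $\mathcal D'\subseteq\mathcal L(A)$ containing $\mathcal D$ equals $\mathcal D$. Two linear orders are alike if they differ by swapping two alternatives in adjacent positions; a path connecting $R$ and $T$ is a sequence $(R_1,\dots,R_k)$, $R_1=R$, $R_k=T$, consecutive orders alike; a geodesic is such a path of minimum length. $\mathcal D$ is directly connected if any two of its orders are connected by a geodesic all of whose orders lie in $\mathcal D$. *)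

theory Defs
  imports "HOL-Combinatorics.Multiset_Permutations"
begin

text \<open>A linear order on a finite set is represented by the word listing its elements from
  top to bottom, so the set of all linear orders on \<open>A\<close> is \<^term>\<open>permutations_of_set A\<close>,
  the set of duplicate-free lists with element set \<open>A\<close>.\<close>

abbreviation linear_orders :: "'a set \<Rightarrow> 'a list set" where
  "linear_orders A \<equiv> permutations_of_set A"

definition restrict_domain :: "'a list set \<Rightarrow> 'a set \<Rightarrow> 'a list set" where
  "restrict_domain D B = filter (\<lambda>x. x \<in> B) ` D"

text \<open>The never condition \<open>xN\<^sub>Bk\<close>. Positions \<open>k\<close> are counted from \<open>1\<close>, whereas
  list indices start at \<open>0\<close>.\<close>

definition never_condition :: "'a list set \<Rightarrow> 'a set \<Rightarrow> 'a \<Rightarrow> nat \<Rightarrow> bool" where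
  "never_condition D B x k \<longleftrightarrow> (\<forall>w \<in> restrict_domain D B. w ! (k - 1) \<noteq> x)"

definition peak_pit_domain :: "'a set \<Rightarrow> 'a list set \<Rightarrow> bool" where
  "peak_pit_domain A D \<longleftrightarrow>
     D \<subseteq> linear_orders A \<and>
     (\<forall>a \<in> A. \<forall>b \<in> A. \<forall>c \<in> A. a \<noteq> b \<and> a \<noteq> c \<and> b \<noteq> c \<longrightarrow>
        (\<exists>x \<in> {a, b, c}. never_condition D {a, b, c} x 1 \<or> never_condition D {a, b, c} x 3))"

definition maximal_peak_pit_domain :: "'a set \<Rightarrow> 'a list set \<Rightarrow> bool" where
  "maximal_peak_pit_domain A D \<longleftrightarrow>
     peak_pit_domain A D \<and> (\<forall>D'. peak_pit_domain A D' \<and> D \<subseteq> D' \<longrightarrow> D' = D)"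

definition alike :: "'a list \<Rightarrow> 'a list \<Rightarrow> bool" where
  "alike R T \<longleftrightarrow> (\<exists>us a b vs. a \<noteq> b \<and> R = us @ [a, b] @ vs \<and> T = us @ [b, a] @ vs)"

definition connecting_path :: "'a set \<Rightarrow> 'a list \<Rightarrow> 'a list \<Rightarrow> 'a list list \<Rightarrow> bool" where
  "connecting_path A R T p \<longleftrightarrow>
     p \<noteq> [] \<and> hd p = R \<and> last p = T \<and> set p \<subseteq> linear_orders A \<and> successively alike p"

text \<open>The minimum is over all paths in \<^term>\<open>linear_orders A\<close>, not only those inside a
  given domain.\<close>

definition geodesic :: "'a set \<Rightarrow> 'a list \<Rightarrow> 'a list \<Rightarrow> 'a list list \<Rightarrow> bool" where
  "geodesic A R T p \<longleftrightarrow>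
     connecting_path A R T p \<and> (\<forall>q. connecting_path A R T q \<longrightarrow> length p \<le> length q)"

definition directly_connected :: "'a set \<Rightarrow> 'a list set \<Rightarrow> bool" where
  "directly_connected A D \<longleftrightarrow>
     (\<forall>R \<in> D. \<forall>T \<in> D. \<exists>p. geodesic A R T p \<and> set p \<subseteq> D)"

end

theory Submission
  imports Defs
begin

text \<open>A maximal peak-pit domain contains the majority relation of any three of its orders, which
  is again a linear order. Given \<open>R \<noteq> T\<close> in the domain, let \<open>S \<noteq> R\<close> be a member between \<open>R\<close>
  and \<open>T\<close> (in the sense of inversion sets) that is closest to \<open>R\<close>, and let \<open>a\<close>, \<open>b\<close> be adjacent
  in \<open>R\<close> and inverted in \<open>S\<close>. If swapping \<open>a\<close> and \<open>b\<close> in \<open>R\<close> left the domain, then by maximality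
  the swapped order would violate the only never condition valid on some triple \<open>{a, b, c}\<close>. As
  the other never conditions fail there, some \<open>Q\<close> in the domain makes the majority order of
  \<open>R\<close>, \<open>S\<close>, \<open>Q\<close> lie strictly between \<open>R\<close> and \<open>S\<close>, a contradiction. So from \<open>R\<close> one can always
  step towards \<open>T\<close> inside the domain, each step removing one inversion.\<close>

section \<open>The order relation of a word\<close>

primrec above :: "'a list \<Rightarrow> 'a \<Rightarrow> 'a \<Rightarrow> bool" where
  "above [] x y \<longleftrightarrow> False"
| "above (z # w) x y \<longleftrightarrow> z = x \<and> y \<in> set w \<or> above w x y"

lemma above_in_set: "above w x y \<Longrightarrow> x \<in> set w \<and> y \<in> set w"
  by (induction w) auto

lemma above_total: "x \<in> set w \<Longrightarrow> y \<in> set w \<Longrightarrow> x \<noteq> y \<Longrightarrow> above w x y \<or> above w y x"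
  by (induction w) auto

lemma above_asym: "distinct w \<Longrightarrow> above w x y \<Longrightarrow> \<not> above w y x"
  by (induction w) (auto dest: above_in_set)

lemma above_trans: "distinct w \<Longrightarrow> above w x y \<Longrightarrow> above w y z \<Longrightarrow> above w x z"
  by (induction w) (auto dest: above_in_set)

lemma above_append:
  "above (u @ v) x y \<longleftrightarrow> above u x y \<or> above v x y \<or> x \<in> set u \<and> y \<in> set v"
  by (induction u) auto

lemma above_filter: "above (filter P w) x y \<longleftrightarrow> P x \<and> P y \<and> above w x y"
  by (induction w) (auto dest: above_in_set)

lemma above_if_sorted_wrt: "sorted_wrt P w \<Longrightarrow> above w x y \<Longrightarrow> P x y"
  by (induction w) auto

lemma nth_first_iff_above:
  assumes "distinct w" "x \<in> set w"
  shows "w ! 0 = x \<longleftrightarrow> (\<forall>y \<in> set w. \<not> above w y x)"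
  using assms by (cases w) (auto dest: above_in_set)

lemma nth_last_iff_above:
  assumes "distinct w" "x \<in> set w"
  shows "w ! (length w - 1) = x \<longleftrightarrow> (\<forall>y \<in> set w. \<not> above w x y)"
  using assms by (cases w rule: rev_cases) (auto simp: above_append dest: above_in_set)

text \<open>One inclusion suffices because both relations are total and asymmetric on the same set.
  If the heads differed, each would be above the other in \<open>w\<close>.\<close>

lemma above_inject:
  assumes "distinct v" "distinct w" "set v = set w" "\<And>x y. above v x y \<Longrightarrow> above w x y"
  shows "v = w"
  using assms
proof (induction v arbitrary: w)
  case Nil
  then show ?case by simp
next
  case (Cons x v)
  obtain y w' where w: "w = y # w'"
    using Cons.prems(3) by (cases w) auto
  have "x = y"
  proof (rule ccontr)
    assume "x \<noteq> y"
    then have "above (x # v) x y"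
      using Cons.prems(3) w by auto
    then have "above w x y" by (rule Cons.prems(4))
    moreover have "above w y x"
      using Cons.prems(3) w \<open>x \<noteq> y\<close> by auto
    ultimately show False
      using Cons.prems(2) above_asym by metis
  qed
  moreover have "v = w'"
  proof (rule Cons.IH)
    show "set v = set w'"
      using Cons.prems(1-3) w \<open>x = y\<close> by (simp add: insert_ident)
    show "above w' p q" if "above v p q" for p q
    proof -
      have "p \<noteq> x"
        using that Cons.prems(1) above_in_set by fastforce
      then show ?thesis
        using Cons.prems(4)[of p q] that w \<open>x = y\<close> by auto
    qed
  qed (use Cons.prems w \<open>x = y\<close> in auto)
  ultimately show ?case using w by simp
qed

lemma above_swap:
  assumes "distinct (us @ [a, b] @ vs)"
  shows "above (us @ [b, a] @ vs) x y \<longleftrightarrow>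
    x = b \<and> y = a \<or> above (us @ [a, b] @ vs) x y \<and> \<not> (x = a \<and> y = b)"
  using assms by (auto simp: above_append dest: above_in_set)

text \<open>If every adjacent pair of \<open>v\<close> were ordered as in \<open>w\<close>,
  transitivity of \<open>above w\<close> would make the whole of \<open>v\<close> sorted by it,
  forcing \<open>v = w\<close>.\<close>

lemma exists_adjacent_inversion:
  assumes "distinct v" "distinct w" "set v = set w" "v \<noteq> w"
  obtains us a b vs where "v = us @ [a, b] @ vs" "above w b a"
proof (rule ccontr)
  assume *: "\<not> thesis"
  have "successively (above w) v"
    unfolding successively_conv_nth
  proof (intro allI impI)
    fix i assume i: "Suc i < length v"
    have eq: "v = take i v @ [v ! i, v ! Suc i] @ drop (Suc (Suc i)) v"
      using i by (metis Cons_nth_drop_Suc Suc_lessD append_Cons append_Nil append_take_drop_id)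
    have "\<not> above w (v ! Suc i) (v ! i)"
      using * that[OF eq] by blast
    moreover have "v ! i \<noteq> v ! Suc i"
      using assms(1) i by (simp add: nth_eq_iff_index_eq)
    ultimately show "above w (v ! i) (v ! Suc i)"
      using above_total[of "v ! i" w "v ! Suc i"] i assms(3) by (metis Suc_lessD nth_mem)
  qed
  moreover have "transp (above w)"
    using above_trans[OF assms(2)] by (auto intro: transpI)
  ultimately have "sorted_wrt (above w) v"
    by (simp add: successively_iff_sorted_wrt_strong transpD)
  then have "v = w"
    using assms(1-3) by (intro above_inject) (auto dest: above_if_sorted_wrt)
  with assms(4) show False by simp
qed

lemma exists_word_of_strict_order:
  assumes "finite A"
    and total: "\<And>x y. x \<in> A \<Longrightarrow> y \<in> A \<Longrightarrow> x \<noteq> y \<Longrightarrow> P x y \<or> P y x"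
    and asym: "\<And>x y. x \<in> A \<Longrightarrow> y \<in> A \<Longrightarrow> P x y \<Longrightarrow> \<not> P y x"
    and trans: "\<And>x y z. x \<in> A \<Longrightarrow> y \<in> A \<Longrightarrow> z \<in> A \<Longrightarrow> P x y \<Longrightarrow> P y z \<Longrightarrow> P x z"
  obtains w where "w \<in> linear_orders A"
    "\<And>x y. x \<in> A \<Longrightarrow> y \<in> A \<Longrightarrow> above w x y \<longleftrightarrow> P x y"
proof -
  \<comment> \<open>The word is obtained by sorting by the number of predecessors under
    \<open>P\<close>, which grows strictly along \<open>P\<close>.\<close>
  define rank where "rank x = card {y \<in> A. P y x}" for x
  obtain v where v: "set v = A" "distinct v"
    using finite_distinct_list[OF \<open>finite A\<close>] by blast
  define w where "w = sort_key rank v"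
  have w: "set w = A" "distinct w"
    using v by (auto simp: w_def)
  have less: "rank x < rank y" if "x \<in> A" "y \<in> A" "P x y" for x y
    unfolding rank_def
  proof (rule psubset_card_mono)
    show "{z \<in> A. P z x} \<subset> {z \<in> A. P z y}"
      using that asym[of x x] trans by blast
  qed (use \<open>finite A\<close> in auto)
  have "sorted_wrt (\<lambda>x y. rank x \<le> rank y) w"
    using sorted_sort_key[of rank v] by (simp add: w_def sorted_map)
  then have le: "rank x \<le> rank y" if "above w x y" for x y
    using that by (rule above_if_sorted_wrt)
  \<comment> \<open>Sorting gives only the weak inequality of ranks, but \<open>less\<close> is
    strict, so \<open>P y x\<close> is excluded and totality leaves \<open>P x y\<close>.\<close>
  have 1: "P x y" if "above w x y" "x \<in> A" "y \<in> A" for x y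
  proof -
    have "x \<noteq> y"
      using that(1) above_asym[OF w(2)] by blast
    moreover have "\<not> P y x"
      using le[OF that(1)] less[of y x] that by auto
    ultimately show ?thesis using total that by blast
  qed
  have 2: "above w x y" if "P x y" "x \<in> A" "y \<in> A" for x y
    using 1[of y x] asym[of x y] above_total[of x w y] that w by blast
  show thesis
  proof (rule that[of w])
    show "w \<in> linear_orders A"
      using w by (simp add: permutations_of_set_def)
  qed (use 1 2 in blast)
qed

section \<open>Inversions and the length of paths\<close>

text \<open>Each inverted pair occurs once, oriented as in \<open>v\<close>; for two linear orders
  on \<open>A\<close> the cardinality is their Kendall tau distance. Betweenness of \<open>S\<close>
  is expressed as \<open>inversions R S \<subseteq> inversions R T\<close>.\<close>

definition inversions :: "'a list \<Rightarrow> 'a list \<Rightarrow> ('a \<times> 'a) set" where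
  "inversions v w = {(x, y). above v x y \<and> above w y x}"

lemma finite_inversions [simp]: "finite (inversions v w)"
  by (rule finite_subset[of _ "set v \<times> set v"]) (auto simp: inversions_def dest: above_in_set)

lemma inversions_self: "distinct w \<Longrightarrow> inversions w w = {}"
  by (auto simp: inversions_def dest: above_asym)

lemma inversions_swap:
  assumes "distinct (us @ [a, b] @ vs)" "distinct w" "above w b a"
  shows "inversions (us @ [a, b] @ vs) w = insert (a, b) (inversions (us @ [b, a] @ vs) w)"
    and "(a, b) \<notin> inversions (us @ [b, a] @ vs) w"
proof -
  have ab: "above (us @ [a, b] @ vs) a b" "a \<noteq> b"
    using assms(1) by (auto simp: above_append)
  show "inversions (us @ [a, b] @ vs) w = insert (a, b) (inversions (us @ [b, a] @ vs) w)"
    unfolding inversions_def above_swap[OF assms(1)]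
    using ab assms(3) above_asym[OF assms(2)] by blast
  show "(a, b) \<notin> inversions (us @ [b, a] @ vs) w"
    unfolding inversions_def above_swap[OF assms(1)] using ab by blast
qed

text \<open>A swap of neighbours changes the relative order of one pair only, so one step of a path
  removes at most one inversion.\<close>

lemma card_inversions_alike:
  assumes "alike v v'" "distinct v"
  shows "card (inversions v w) \<le> Suc (card (inversions v' w))"
proof -
  obtain us a b vs where v: "v = us @ [a, b] @ vs" "v' = us @ [b, a] @ vs"
    using assms(1) by (auto simp: alike_def)
  have "inversions v w \<subseteq> insert (a, b) (inversions v' w)"
    using above_swap assms(2) unfolding v inversions_def by fast
  then have "card (inversions v w) \<le> card (insert (a, b) (inversions v' w))"
    by (intro card_mono) auto
  also have "\<dots> \<le> Suc (card (inversions v' w))"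
    by (simp add: card_insert_if)
  finally show ?thesis .
qed

text \<open>The lower bound behind all geodesics here. It is strict because \<open>length p\<close>
  counts the orders on the path, one more than its steps.\<close>

lemma card_inversions_less_length:
  "connecting_path A v w p \<Longrightarrow> card (inversions v w) < length p"
proof (induction p arbitrary: v)
  case Nil
  then show ?case by (simp add: connecting_path_def)
next
  case (Cons u p)
  have v: "u = v" "distinct v"
    using Cons.prems by (auto simp: connecting_path_def permutations_of_set_def)
  show ?case
  proof (cases p)
    case Nil
    then show ?thesis
      using Cons.prems v by (simp add: connecting_path_def inversions_self)
  next
    case (Cons v' p')
    have "connecting_path A v' w p" "alike v v'"
      using Cons.prems Cons v by (auto simp: connecting_path_def)
    then show ?thesis
      using Cons.IH[of v'] card_inversions_alike[of v v' w] v by fastforce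
  qed
qed

lemma geodesic_if_length:
  "connecting_path A v w p \<Longrightarrow> length p = Suc (card (inversions v w)) \<Longrightarrow> geodesic A v w p"
  unfolding geodesic_def using card_inversions_less_length[of A v w] by fastforce

section \<open>Never conditions in terms of \<open>above\<close>\<close>

context
  fixes D :: "'a list set" and A B :: "'a set" and x :: 'a
  assumes D: "D \<subseteq> linear_orders A" and B: "B \<subseteq> A" and x: "x \<in> B"
begin

lemma restrict_word:
  assumes "w \<in> D"
  shows "distinct (filter (\<lambda>y. y \<in> B) w)" "set (filter (\<lambda>y. y \<in> B) w) = B"
  using assms D B by (auto simp: permutations_of_set_def)

lemma never_first_iff:
  "never_condition D B x 1 \<longleftrightarrow> (\<forall>w \<in> D. \<exists>y \<in> B. above w y x)"
proof -
  have "filter (\<lambda>y. y \<in> B) w ! 0 \<noteq> x \<longleftrightarrow> (\<exists>y \<in> B. above w y x)" if "w \<in> D" for w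
    using nth_first_iff_above[of "filter (\<lambda>y. y \<in> B) w" x] restrict_word[OF that] x
    by (auto simp: above_filter)
  then show ?thesis
    by (auto simp: never_condition_def restrict_domain_def)
qed

lemma never_last_iff:
  assumes "card B = k"
  shows "never_condition D B x k \<longleftrightarrow> (\<forall>w \<in> D. \<exists>y \<in> B. above w x y)"
proof -
  have "filter (\<lambda>y. y \<in> B) w ! (k - 1) \<noteq> x \<longleftrightarrow> (\<exists>y \<in> B. above w x y)" if "w \<in> D" for w
  proof -
    have "length (filter (\<lambda>y. y \<in> B) w) = k"
      using restrict_word[OF that] assms distinct_card by metis
    then show ?thesis
      using nth_last_iff_above[of "filter (\<lambda>y. y \<in> B) w" x] restrict_word[OF that] x
      by (auto simp: above_filter)
  qed
  then show ?thesis
    by (auto simp: never_condition_def restrict_domain_def)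
qed

end

text \<open>This and \<open>never_bottom\<close> are the position-free forms found in
  \<open>never_first_iff\<close> and \<open>never_last_iff\<close>; position 3 is the bottom because
  the set has three elements.\<close>

definition never_top :: "'a list set \<Rightarrow> 'a set \<Rightarrow> 'a \<Rightarrow> bool" where
  "never_top D B x \<longleftrightarrow> (\<forall>w \<in> D. \<exists>y \<in> B. above w y x)"

definition never_bottom :: "'a list set \<Rightarrow> 'a set \<Rightarrow> 'a \<Rightarrow> bool" where
  "never_bottom D B x \<longleftrightarrow> (\<forall>w \<in> D. \<exists>y \<in> B. above w x y)"

text \<open>Triples become sets of cardinality three, so that later their elements can be named in
  whichever order suits.\<close>

lemma peak_pit_domain_iff:
  "peak_pit_domain A D \<longleftrightarrow> D \<subseteq> linear_orders A \<and>
    (\<forall>B. B \<subseteq> A \<and> card B = 3 \<longrightarrow> (\<exists>x \<in> B. never_top D B x \<or> never_bottom D B x))"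
proof (cases "D \<subseteq> linear_orders A")
  case True
  have eq: "(\<exists>x \<in> B. never_condition D B x 1 \<or> never_condition D B x 3) \<longleftrightarrow>
      (\<exists>x \<in> B. never_top D B x \<or> never_bottom D B x)" if "B \<subseteq> A" "card B = 3" for B
    using never_first_iff[OF True that(1)] never_last_iff[OF True that(1) _ that(2)]
    unfolding never_top_def never_bottom_def by blast
  have triples: "(\<forall>B. B \<subseteq> A \<and> card B = 3 \<longrightarrow> Q B) \<longleftrightarrow>
      (\<forall>a \<in> A. \<forall>b \<in> A. \<forall>c \<in> A. a \<noteq> b \<and> a \<noteq> c \<and> b \<noteq> c \<longrightarrow> Q {a, b, c})" for Q
    unfolding card_3_iff by (safe; metis insert_subset empty_subsetI)
  have "(\<forall>B. B \<subseteq> A \<and> card B = 3 \<longrightarrow>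
        (\<exists>x \<in> B. never_condition D B x 1 \<or> never_condition D B x 3)) \<longleftrightarrow>
      (\<forall>B. B \<subseteq> A \<and> card B = 3 \<longrightarrow> (\<exists>x \<in> B. never_top D B x \<or> never_bottom D B x))"
    using eq by blast
  then show ?thesis
    unfolding peak_pit_domain_def triples by argo
qed (simp add: peak_pit_domain_def)

section \<open>Majority of three orders\<close>

definition majority :: "'a list \<Rightarrow> 'a list \<Rightarrow> 'a list \<Rightarrow> 'a \<Rightarrow> 'a \<Rightarrow> bool" where
  "majority u v w x y \<longleftrightarrow>
    above u x y \<and> above v x y \<or> above u x y \<and> above w x y \<or> above v x y \<and> above w x y"

text \<open>The only form in which maximality enters, beyond the peak-pit property itself.\<close>

lemma maximal_peak_pit_memI:
  assumes "maximal_peak_pit_domain A D" "peak_pit_domain A (insert w D)"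
  shows "w \<in> D"
  using assms unfolding maximal_peak_pit_domain_def by blast

text \<open>Any two majorities among three voters share a voter. Hence a majority cycle on a triple would
  put each of its alternatives once on top and once at the bottom, and an alternative on top of
  a triple in the majority order is on top for some voter.\<close>

lemma maximal_peak_pit_majority_closed:
  assumes "finite A" "maximal_peak_pit_domain A D" "u \<in> D" "v \<in> D" "w \<in> D"
  obtains m where "m \<in> D" "\<And>x y. x \<in> A \<Longrightarrow> y \<in> A \<Longrightarrow> above m x y \<longleftrightarrow> majority u v w x y"
proof -
  have pp: "D \<subseteq> linear_orders A"
    "\<And>B. B \<subseteq> A \<Longrightarrow> card B = 3 \<Longrightarrow> \<exists>x \<in> B. never_top D B x \<or> never_bottom D B x"
    using assms(2) unfolding maximal_peak_pit_domain_def peak_pit_domain_iff by auto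
  have D: "distinct z" "set z = A" if "z \<in> D" for z
    using pp(1) that by (auto simp: permutations_of_set_def)
  have asym: "\<not> above z y x" if "z \<in> D" "above z x y" for z x y
    using above_asym D that by metis
  have total: "above z x y \<or> above z y x" if "z \<in> D" "x \<in> A" "y \<in> A" "x \<noteq> y" for z x y
    using above_total D that by metis
  have maj_total: "majority u v w x y \<or> majority u v w y x"
    if "x \<in> A" "y \<in> A" "x \<noteq> y" for x y
    using total[OF _ that] assms(3-5) unfolding majority_def by blast
  have maj_asym: "\<not> majority u v w y x" if "majority u v w x y" for x y
    using that asym assms(3-5) unfolding majority_def by blast
  have common: "\<exists>z \<in> D. above z x y \<and> above z x' y'"
    if "majority u v w x y" "majority u v w x' y'" for x y x' y'
    using that assms(3-5) unfolding majority_def by blast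
  have maj_trans: "majority u v w x z"
    if A: "x \<in> A" "y \<in> A" "z \<in> A" and xy: "majority u v w x y" and yz: "majority u v w y z"
    for x y z
  proof (rule ccontr)
    assume neg: "\<not> majority u v w x z"
    have ne: "x \<noteq> y" "y \<noteq> z" "x \<noteq> z"
      using xy yz maj_asym by blast+
    then have zx: "majority u v w z x"
      using maj_total A neg by blast
    obtain p q r where pqr: "p \<in> D" "above p x y" "above p y z" "q \<in> D" "above q y z" "above q z x"
      "r \<in> D" "above r z x" "above r x y"
      using common[OF xy yz] common[OF yz zx] common[OF zx xy] by blast
    then have "above p x z" "above q y x" "above r z y"
      using above_trans D by metis+
    then have "\<not> never_top D {x, y, z} t \<and> \<not> never_bottom D {x, y, z} t" if "t \<in> {x, y, z}" for t
      using that pqr asym unfolding never_top_def never_bottom_def by blast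
    moreover have "card {x, y, z} = 3"
      using ne by simp
    ultimately show False
      using pp(2)[of "{x, y, z}"] A by blast
  qed
  obtain m where m: "m \<in> linear_orders A"
    "\<And>x y. x \<in> A \<Longrightarrow> y \<in> A \<Longrightarrow> above m x y \<longleftrightarrow> majority u v w x y"
    using exists_word_of_strict_order[of A "majority u v w"] assms(1) maj_total maj_asym maj_trans
    by blast
  have "peak_pit_domain A (insert m D)"
    unfolding peak_pit_domain_iff
  proof (intro conjI allI impI)
    show "insert m D \<subseteq> linear_orders A"
      using m(1) pp(1) by auto
    fix B assume B: "B \<subseteq> A \<and> card B = 3"
    \<comment> \<open>Adding \<open>m\<close> preserves the very condition that holds in
      \<open>D\<close>, with the same \<open>x\<close> and at the same end.\<close>
    then obtain x where x: "x \<in> B" "never_top D B x \<or> never_bottom D B x"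
      using pp(2) by blast
    obtain y z where "B = {x, y, z}" "x \<noteq> y" "x \<noteq> z"
    proof -
      have "card (B - {x}) = 2"
        using B x(1) by simp
      then obtain y z where "B - {x} = {y, z}"
        by (auto simp: card_2_iff)
      then show thesis
        using that[of y z] x(1) by blast
    qed
    then have xyz: "B = {x, y, z}" "x \<noteq> y" "x \<noteq> z" "x \<in> A" "y \<in> A" "z \<in> A"
      using B by auto
    have "never_top (insert m D) B x" if "never_top D B x"
    proof -
      have "\<exists>t \<in> B. majority u v w t x"
      proof (rule ccontr)
        assume "\<not> ?thesis"
        then have "majority u v w x y" "majority u v w x z"
          using maj_total xyz by blast+
        then obtain d where "d \<in> D" "above d x y" "above d x z"
          using common by blast
        then show False
          using that xyz(1) asym unfolding never_top_def by blast
      qed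
      then show ?thesis
        using that m(2) B x(1) unfolding never_top_def by blast
    qed
    moreover have "never_bottom (insert m D) B x" if "never_bottom D B x"
    proof -
      have "\<exists>t \<in> B. majority u v w x t"
      proof (rule ccontr)
        assume "\<not> ?thesis"
        then have "majority u v w y x" "majority u v w z x"
          using maj_total xyz by blast+
        then obtain d where "d \<in> D" "above d y x" "above d z x"
          using common by blast
        then show False
          using that xyz(1) asym unfolding never_bottom_def by blast
      qed
      then show ?thesis
        using that m(2) B x(1) unfolding never_bottom_def by blast
    qed
    ultimately show "\<exists>x \<in> B. never_top (insert m D) B x \<or> never_bottom (insert m D) B x"
      using x by blast
  qed
  then have "m \<in> D"
    using maximal_peak_pit_memI assms(2) by blast
  then show thesis
    using that m(2) by blast
qed

section \<open>Swaps inside the domain\<close>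

text \<open>\<open>Q\<close> is chosen to vote with \<open>R\<close> on \<open>a\<close>,
  \<open>b\<close>, and with \<open>S\<close> against \<open>R\<close> on a pair involving
  \<open>c\<close>. The majority of \<open>R\<close>, \<open>S\<close>, \<open>Q\<close> then moves
  away from \<open>R\<close>, but not as far as \<open>S\<close>.\<close>

lemma exists_blocking_order:
  assumes "maximal_peak_pit_domain A D" "R \<in> D" "S \<in> D"
    and R: "R = us @ [a, b] @ vs" and ba: "above S b a" and notin: "us @ [b, a] @ vs \<notin> D"
  obtains Q c where "Q \<in> D" "above Q a b"
    "above R b c \<and> above Q c b \<and> above S c b \<or> above R c a \<and> above Q a c \<and> above S a c"
proof -
  define R' where "R' = us @ [b, a] @ vs"
  have pp: "D \<subseteq> linear_orders A"
    "\<And>B. B \<subseteq> A \<Longrightarrow> card B = 3 \<Longrightarrow> \<exists>x \<in> B. never_top D B x \<or> never_bottom D B x"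
    using assms(1) unfolding maximal_peak_pit_domain_def peak_pit_domain_iff by auto
  have D: "distinct z" "set z = A" if "z \<in> D" for z
    using pp(1) that by (auto simp: permutations_of_set_def)
  have asym: "\<not> above z y x" if "z \<in> D" "above z x y" for z x y
    using above_asym D that by metis
  have total: "above z x y \<or> above z y x" if "z \<in> D" "x \<in> A" "y \<in> A" "x \<noteq> y" for z x y
    using above_total D that by metis
  have swap: "above R' x y \<longleftrightarrow> x = b \<and> y = a \<or> above R x y \<and> \<not> (x = a \<and> y = b)" for x y
    using above_swap D[OF assms(2)] unfolding R R'_def by fast
  have ab: "a \<noteq> b" "a \<in> A" "b \<in> A" "above R a b"
    using D[OF assms(2)] unfolding R by (auto simp: above_append)
  have "R' \<in> linear_orders A"
    using D[OF assms(2)] unfolding R R'_def by (auto simp: permutations_of_set_def)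
  moreover have "\<not> peak_pit_domain A (insert R' D)"
    using maximal_peak_pit_memI[OF assms(1)] notin R'_def by blast
  ultimately obtain B where B: "B \<subseteq> A" "card B = 3"
    and no: "\<And>x. x \<in> B \<Longrightarrow> \<not> never_top (insert R' D) B x \<and> \<not> never_bottom (insert R' D) B x"
    using pp(1) unfolding peak_pit_domain_iff by blast
  obtain x where x: "x \<in> B" "never_top D B x \<or> never_bottom D B x"
    using pp(2)[OF B] by blast
  \<comment> \<open>A triple missing \<open>a\<close> or \<open>b\<close> does not see the swap, so
    \<open>R'\<close> would satisfy there whatever \<open>R\<close> does.\<close>
  have "a \<in> B \<and> b \<in> B"
  proof (rule ccontr)
    assume "\<not> ?thesis"
    then have "above R' p q \<longleftrightarrow> above R p q" if "p \<in> B" "q \<in> B" for p q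
      using swap[of p q] that \<open>\<not> (a \<in> B \<and> b \<in> B)\<close> by auto
    then show False
      using x no[OF x(1)] assms(2) unfolding never_top_def never_bottom_def by blast
  qed
  then have "card (B - {a, b}) = 1"
    using B ab(1) by (simp add: card_Diff_subset)
  then obtain c where "B - {a, b} = {c}"
    by (auto simp: card_1_singleton_iff)
  then have Bc: "B = {a, b, c}" "c \<noteq> a" "c \<noteq> b" "c \<in> A"
    using \<open>a \<in> B \<and> b \<in> B\<close> B by blast+
  \<comment> \<open>Since \<open>a\<close> and \<open>b\<close> are adjacent in \<open>R\<close>,
    the alternative \<open>c\<close> is below both or above both.\<close>
  have "above R b c \<or> above R c a"
    using D(2)[OF assms(2)] Bc unfolding R by (auto simp: above_append)
  then consider "above R b c" | "above R c a" by blast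
  then show thesis
  proof cases
    case 1
    then have Rac: "above R a c"
      using above_trans D(1)[OF assms(2)] ab(4) by metis
    have R': "above R' b a" "above R' b c" "above R' a c"
      using swap 1 Rac ab Bc by auto
    \<comment> \<open>On \<open>B\<close>, \<open>R\<close> reads \<open>a b c\<close> and
      \<open>R'\<close> reads \<open>b a c\<close>. The only condition compatible with the former
      and broken by the latter is that \<open>b\<close> is never on top.\<close>
    have "never_top D B b"
      using x no[OF x(1)] R' ab(4) 1 Rac assms(2) asym
      unfolding never_top_def never_bottom_def Bc(1) by blast
    \<comment> \<open>In \<open>S\<close>, \<open>a\<close> is below \<open>b\<close>, so only
      \<open>c\<close> can keep \<open>b\<close> off the top.\<close>
    then have "above S c b"
      using assms(3) ba asym[OF assms(3)] unfolding never_top_def Bc(1) by blast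
    \<comment> \<open>That \<open>b\<close> is never at the bottom fails once \<open>R'\<close> is
      added; \<open>R'\<close> has \<open>b\<close> on top, so the failure comes from
      \<open>D\<close>.\<close>
    obtain Q where Q: "Q \<in> D" "\<And>y. y \<in> B \<Longrightarrow> \<not> above Q b y"
      using no[of b] R' unfolding never_bottom_def Bc(1) by blast
    then have "above Q a b" "above Q c b"
      using total ab Bc by blast+
    then show thesis
      using that Q(1) 1 \<open>above S c b\<close> by blast
  \<comment> \<open>Mirror image: reverse all words and exchange \<open>a\<close> with
    \<open>b\<close>.\<close>
  next
    case 2
    then have Rcb: "above R c b"
      using above_trans D(1)[OF assms(2)] ab(4) by metis
    have R': "above R' b a" "above R' c b" "above R' c a"
      using swap 2 Rcb ab Bc by auto
    have "never_bottom D B a"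
      using x no[OF x(1)] R' ab(4) 2 Rcb assms(2) asym
      unfolding never_top_def never_bottom_def Bc(1) by blast
    then have "above S a c"
      using assms(3) ba asym[OF assms(3)] unfolding never_bottom_def Bc(1) by blast
    obtain Q where Q: "Q \<in> D" "\<And>y. y \<in> B \<Longrightarrow> \<not> above Q y a"
      using no[of a] R' unfolding never_top_def Bc(1) by blast
    then have "above Q a b" "above Q a c"
      using total ab Bc by blast+
    then show thesis
      using that Q(1) 2 \<open>above S a c\<close> by blast
  qed
qed

lemma exists_swap_towards:
  assumes "finite A" "maximal_peak_pit_domain A D" "R \<in> D" "T \<in> D" "R \<noteq> T"
  obtains us a b vs where "R = us @ [a, b] @ vs" "us @ [b, a] @ vs \<in> D" "above T b a"
proof -
  have D: "distinct z" "set z = A" if "z \<in> D" for z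
    using assms(2) that
    by (auto simp: maximal_peak_pit_domain_def peak_pit_domain_def permutations_of_set_def)
  \<comment> \<open>The members other than \<open>R\<close> that lie between \<open>R\<close> and
    \<open>T\<close>; \<open>T\<close> is one of them, so a closest one exists.\<close>
  define I where "I S \<longleftrightarrow> S \<in> D \<and> S \<noteq> R \<and> inversions R S \<subseteq> inversions R T" for S
  have "I T"
    using assms by (simp add: I_def)
  then obtain S where S: "I S" "\<And>M. I M \<Longrightarrow> card (inversions R S) \<le> card (inversions R M)"
    using ex_has_least_nat[of I T "\<lambda>M. card (inversions R M)"] by blast
  then have SD: "S \<in> D" "S \<noteq> R" "inversions R S \<subseteq> inversions R T"
    by (auto simp: I_def)
  obtain us a b vs where R: "R = us @ [a, b] @ vs" and ba: "above S b a"
    using exists_adjacent_inversion[of R S] D assms(3) SD by metis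
  have ab: "above R a b"
    unfolding R by (simp add: above_append)
  have AR: "x \<in> A \<and> y \<in> A" if "above R x y" for x y
    using above_in_set[OF that] D[OF assms(3)] by blast
  have "us @ [b, a] @ vs \<in> D"
  proof (rule ccontr)
    assume "us @ [b, a] @ vs \<notin> D"
    then obtain Q c where Q: "Q \<in> D" "above Q a b"
      "above R b c \<and> above Q c b \<and> above S c b \<or> above R c a \<and> above Q a c \<and> above S a c"
      using exists_blocking_order[OF assms(2,3) SD(1) R ba] by blast
    obtain M where M: "M \<in> D"
      "\<And>x y. x \<in> A \<Longrightarrow> y \<in> A \<Longrightarrow> above M x y \<longleftrightarrow> majority R S Q x y"
      using maximal_peak_pit_majority_closed[OF assms(1,2,3) SD(1) Q(1)] by blast
    have asymR: "\<not> above R y x" if "above R x y" for x y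
      using above_asym[OF D(1)[OF assms(3)] that] .
    \<comment> \<open>To outvote \<open>R\<close> on a pair, \<open>S\<close> and \<open>Q\<close>
      must both invert it.\<close>
    have "inversions R M \<subseteq> inversions R S"
      using M(2) AR asymR unfolding inversions_def majority_def by blast
    moreover have "(a, b) \<in> inversions R S - inversions R M"
    proof -
      have "above M a b"
        using M(2) AR ab Q(2) unfolding majority_def by blast
      then show ?thesis
        using ab ba above_asym[OF D(1)[OF M(1)]] unfolding inversions_def by blast
    qed
    ultimately have "inversions R M \<subset> inversions R S"
      by blast
    then have "card (inversions R M) < card (inversions R S)"
      by (simp add: psubset_card_mono)
    \<comment> \<open>\<open>S\<close> and \<open>Q\<close> jointly outvote \<open>R\<close> on the
      pair involving \<open>c\<close>.\<close>
    moreover have "M \<noteq> R"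
      using Q(3) M(2) AR asymR unfolding majority_def by metis
    then have "I M"
      using M(1) \<open>inversions R M \<subset> inversions R S\<close> SD(3) unfolding I_def by blast
    ultimately show False
      using S(2)[of M] by simp
  qed
  moreover have "above T b a"
    using SD(3) ab ba unfolding inversions_def by blast
  ultimately show thesis
    using that R by blast
qed

section \<open>Geodesics inside the domain\<close>

text \<open>Each swap towards \<open>T\<close> removes exactly one inversion, so repeating it
  reaches \<open>T\<close> by a path in \<open>D\<close> that attains the lower bound of
  \<open>card_inversions_less_length\<close>.\<close>

lemma exists_path_of_inversions_length:
  assumes "finite A" "maximal_peak_pit_domain A D" "R \<in> D" "T \<in> D"
  shows "\<exists>p. connecting_path A R T p \<and> set p \<subseteq> D \<and> length p = Suc (card (inversions R T))"
  using assms(3)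
proof (induction "card (inversions R T)" arbitrary: R rule: less_induct)
  case less
  have sub: "D \<subseteq> linear_orders A"
    using assms(2) by (simp add: maximal_peak_pit_domain_def peak_pit_domain_def)
  then have D: "distinct z" if "z \<in> D" for z
    using that by (auto simp: permutations_of_set_def)
  show ?case
  proof (cases "R = T")
    case True
    then show ?thesis
      using less.prems sub D
      by (intro exI[of _ "[R]"]) (auto simp: connecting_path_def inversions_self)
  next
    case False
    obtain us a b vs where R: "R = us @ [a, b] @ vs" and R'D: "us @ [b, a] @ vs \<in> D"
      and ba: "above T b a"
      using exists_swap_towards[OF assms(1,2) less.prems assms(4) False] .
    let ?R' = "us @ [b, a] @ vs"
    have card: "card (inversions R T) = Suc (card (inversions ?R' T))"
      using inversions_swap[of us a b vs T] D[OF less.prems] D[OF assms(4)] ba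
      unfolding R by simp
    then obtain p where p: "connecting_path A ?R' T p" "set p \<subseteq> D"
        "length p = Suc (card (inversions ?R' T))"
      using less.hyps[of ?R'] R'D by auto
    have "a \<noteq> b"
      using D[OF less.prems] unfolding R by simp
    then have "alike R ?R'"
      unfolding alike_def R by blast
    then have "connecting_path A R T (R # p)"
      using p(1) less.prems sub by (auto simp: connecting_path_def successively_Cons)
    then show ?thesis
      using p card less.prems by (intro exI[of _ "R # p"]) auto
  qed
qed

theorem theorem1:
  fixes A :: "'a set" and D :: "'a list set"
  assumes "finite A"
    and "maximal_peak_pit_domain A D"
  shows "directly_connected A D"
  unfolding directly_connected_def
  by (meson exists_path_of_inversions_length[OF assms] geodesic_if_length)

end
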